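(* Let $a,b,p,q\in\mathbb{Z}$, let $(h_n)$ be defined by $h_0=a$, $h_1=b$, $h_n=ph_{n-1}+qh_{n-2}$ for $n\ge 2$, let $n\ge 1$ and $\mathbf{h}=(h_0,\dots,h_{n-1})$. If $h_i\ge 0$ for all $i=0,\dots,n-1$, then $$\|\mathbf{C}(\mathbf{h})\|=h_0+\dots+h_{n-1},$$ where: if $p+q\ne 1$, then $h_0+\dots+h_{n-1}=\dfrac{h_n+qh_{n-1}+(p-1)a-b}{p+q-1}$; if $p+q=1$ and $p\ne 2$, then $h_0+\dots+h_{n-1}=\dfrac{qh_{n-1}+(n-1)(qa+b)+a}{q+1}$; if $p=2$ and $q=-1$, then $h_0+\dots+h_{n-1}=n\,\dfrac{h_{n-1}+a}{2}$.
   Context: For $\mathbf{x}=(x_0,\dots,x_{n-1})\in\mathbb{R}^n$, the circulant matrix $\mathbf{C}(\mathbf{x})$ is the $n\times n$ matrix whose first row is $(x_0,x_1,\dots,x_{n-1})$ and each subsequent row is the cyclic right shift of the previous one; i.e. its $(r,c)$ entry ($r,c=1,\dots,n$) is $x_{(c-r) \bmod n}$. $\|\cdot\|$ denotes the spectral norm. *)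

theory Defs
  imports Complex_Main "Jordan_Normal_Form.Schur_Decomposition" "Jordan_Normal_Form.Spectral_Radius"
begin

fun horadam :: "int \<Rightarrow> int \<Rightarrow> int \<Rightarrow> int \<Rightarrow> nat \<Rightarrow> int" where
  "horadam a b p q 0 = a"
| "horadam a b p q (Suc 0) = b"
| "horadam a b p q (Suc (Suc n)) = p * horadam a b p q (Suc n) + q * horadam a b p q n"

(* Rows and columns are numbered from 0, which leaves c - r unchanged. The difference is
   taken in int, so that mod yields the representative in {0..<n} also when c < r. *)
definition circulant :: "'a vec \<Rightarrow> 'a mat" where
  "circulant x = mat (dim_vec x) (dim_vec x)
     (\<lambda>(r, c). x $ nat ((int c - int r) mod int (dim_vec x)))"

(* The largest singular value: the square root of the largest eigenvalue of A^H A, whose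
   eigenvalues are real and nonnegative and hence equal to their moduli. *)
definition spectral_norm :: "complex mat \<Rightarrow> real" where
  "spectral_norm A = sqrt (spectral_radius (mat_adjoint A * A))"

end

(*
  A circulant matrix with nonnegative entries has all row and column sums equal to
  S = h_0 + ... + h_(n-1), so A^T A is a nonnegative matrix with all row sums S^2. The all-ones
  vector is then an eigenvector for S^2, and comparing a coordinate of maximal modulus of an
  arbitrary eigenvector with the row sum shows that no eigenvalue has larger modulus.
  The closed forms come from summing the recurrence; when p + q = 1 the quantity
  h_(i+1) + q h_i is constant.
*)
theory Submission
  imports Defs
begin

text \<open>An elementary case of Perron-Frobenius: constant row sums provide a positive
  eigenvector, the all-ones vector, in advance.\<close>

lemma spectral_radius_const_row_sums:
  fixes B :: "real mat"
  assumes B: "B \<in> carrier_mat n n" and n: "n > 0"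
    and nonneg: "\<And>i j. i < n \<Longrightarrow> j < n \<Longrightarrow> B $$ (i, j) \<ge> 0"
    and sums: "\<And>i. i < n \<Longrightarrow> (\<Sum>j<n. B $$ (i, j)) = s"
  shows "spectral_radius (map_mat complex_of_real B) = s"
proof (rule antisym)
  let ?B = "map_mat complex_of_real B"
  have CB: "?B \<in> carrier_mat n n" using B by simp
  have mult_nth: "(?B *\<^sub>v v) $ i = (\<Sum>j<n. of_real (B $$ (i, j)) * v $ j)"
    if "v \<in> carrier_vec n" "i < n" for v i
    using that B by (auto simp: scalar_prod_def atLeast0LessThan intro!: sum.cong)
  have s0: "s \<ge> 0"
    using sums[OF n] nonneg[OF n] by (metis lessThan_iff sum_nonneg)
  obtain k where k: "eigenvalue ?B k" and sr: "spectral_radius ?B = norm k"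
    using spectral_radius_mem_max(1)[OF CB n] by (auto simp: spectrum_def)
  obtain v where v: "v \<in> carrier_vec n" "v \<noteq> 0\<^sub>v n" "?B *\<^sub>v v = k \<cdot>\<^sub>v v"
    using k B by (auto simp: eigenvalue_def eigenvector_def)
  define m where "m = Max ((\<lambda>j. norm (v $ j)) ` {..<n})"
  have ub: "norm (v $ j) \<le> m" if "j < n" for j
    unfolding m_def using that by (intro Max_ge) auto
  have "m \<in> (\<lambda>j. norm (v $ j)) ` {..<n}"
    unfolding m_def using n by (intro Max_in) auto
  then obtain i where i: "i < n" and mi: "m = norm (v $ i)" by auto
  \<comment> \<open>Positivity of \<open>m\<close> is what allows it to be cancelled from
    \<open>norm k * m \<le> s * m\<close> below.\<close>
  have mpos: "m > 0"
  proof (rule ccontr)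
    assume "\<not> m > 0"
    then have "v $ j = 0" if "j < n" for j
      using ub[OF that] norm_ge_zero[of "v $ j"] by (simp add: mi)
    then have "v = 0\<^sub>v n" using v(1) by (intro eq_vecI) auto
    with v(2) show False by simp
  qed
  \<comment> \<open>The eigenvalue equation is read off at the maximal coordinate \<open>i\<close>;
    the triangle inequality then bounds every other coordinate by \<open>m\<close>.\<close>
  have "norm k * m = norm (k * v $ i)" by (simp add: norm_mult mi)
  also have "k * v $ i = (\<Sum>j<n. of_real (B $$ (i, j)) * v $ j)"
    using arg_cong[OF v(3), of "\<lambda>w. w $ i"] mult_nth[OF v(1) i] v(1) i by simp
  also have "norm \<dots> \<le> (\<Sum>j<n. B $$ (i, j) * m)"
    using nonneg[OF i] ub by (intro sum_norm_le) (auto simp: norm_mult intro!: mult_left_mono)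
  also have "\<dots> = s * m" by (simp add: sums[OF i] flip: sum_distrib_right)
  finally show "spectral_radius ?B \<le> s" using mpos sr by simp
  \<comment> \<open>Reverse inequality: \<open>s\<close> itself is an eigenvalue, with eigenvector
    \<open>u\<close>, and its modulus is \<open>s\<close> by \<open>s0\<close>.\<close>
  define u :: "complex vec" where "u = vec n (\<lambda>_. 1)"
  have "?B *\<^sub>v u = of_real s \<cdot>\<^sub>v u"
  proof (rule eq_vecI)
    fix j assume "j < dim_vec (of_real s \<cdot>\<^sub>v u)"
    then have j: "j < n" by (simp add: u_def)
    have "(?B *\<^sub>v u) $ j = (\<Sum>l<n. of_real (B $$ (j, l)))"
      using mult_nth[of u j] j by (simp add: u_def)
    also have "\<dots> = of_real s" by (simp add: sums[OF j] flip: of_real_sum)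
    finally show "(?B *\<^sub>v u) $ j = (of_real s \<cdot>\<^sub>v u) $ j" using j by (simp add: u_def)
  qed (use B in \<open>simp add: u_def\<close>)
  moreover have "u \<noteq> 0\<^sub>v n"
    using n by (metis index_vec index_zero_vec(1) u_def zero_neq_one)
  ultimately have "eigenvector ?B u (of_real s)"
    using B by (simp add: eigenvector_def u_def)
  then have "norm (complex_of_real s) \<le> spectral_radius ?B"
    by (intro spectral_radius_mem_max(2)[OF CB n] imageI) (auto simp: spectrum_def eigenvalue_def)
  then show "s \<le> spectral_radius ?B" using s0 by simp
qed

lemma mat_adjoint_of_real:
  "mat_adjoint (map_mat complex_of_real B) = map_mat complex_of_real (transpose_mat B)"
  by (rule eq_matI) (auto simp: mat_adjoint_def mat_of_rows_index)

lemma spectral_norm_const_line_sums: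
  fixes B :: "real mat"
  assumes B: "B \<in> carrier_mat n n" and n: "n > 0"
    and nonneg: "\<And>i j. i < n \<Longrightarrow> j < n \<Longrightarrow> B $$ (i, j) \<ge> 0"
    and rows: "\<And>i. i < n \<Longrightarrow> (\<Sum>j<n. B $$ (i, j)) = s"
    and cols: "\<And>j. j < n \<Longrightarrow> (\<Sum>i<n. B $$ (i, j)) = s"
  shows "spectral_norm (map_mat complex_of_real B) = s"
proof -
  let ?P = "transpose_mat B * B"
  have P: "?P $$ (i, j) = (\<Sum>k<n. B $$ (k, i) * B $$ (k, j))" if "i < n" "j < n" for i j
    using that B by (auto simp: scalar_prod_def atLeast0LessThan intro!: sum.cong)
  have "spectral_radius (map_mat complex_of_real ?P) = s\<^sup>2"
  proof (rule spectral_radius_const_row_sums[OF _ n])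
    show "?P \<in> carrier_mat n n" using B by simp
    show "?P $$ (i, j) \<ge> 0" if "i < n" "j < n" for i j
      using that nonneg by (auto simp: P intro!: sum_nonneg)
    fix i assume i: "i < n"
    have "(\<Sum>j<n. ?P $$ (i, j)) = (\<Sum>j<n. \<Sum>k<n. B $$ (k, i) * B $$ (k, j))"
      using i by (simp add: P)
    \<comment> \<open>After the swap the inner sum is a row sum of \<open>B\<close>; pulling it out
      leaves a column sum, so each kind contributes one factor \<open>s\<close>.\<close>
    also have "\<dots> = (\<Sum>k<n. B $$ (k, i) * (\<Sum>j<n. B $$ (k, j)))"
      by (subst sum.swap) (simp add: sum_distrib_left)
    also have "\<dots> = s\<^sup>2"
      using cols[OF i] by (simp add: rows power2_eq_square flip: sum_distrib_right)
    finally show "(\<Sum>j<n. ?P $$ (i, j)) = s\<^sup>2" .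
  qed
  moreover have "map_mat complex_of_real ?P
      = map_mat complex_of_real (transpose_mat B) * map_mat complex_of_real B"
    using B by (intro of_real_hom.mat_hom_mult) auto
  \<comment> \<open>The sign ensures that the square root of the square of \<open>s\<close> is
    \<open>s\<close>, not \<open>-s\<close>.\<close>
  moreover have "s \<ge> 0"
    using rows[OF n] nonneg[OF n] by (metis lessThan_iff sum_nonneg)
  ultimately show ?thesis by (simp add: spectral_norm_def mat_adjoint_of_real)
qed

lemma circulant_index_less: "n > 0 \<Longrightarrow> nat (k mod int n) < n"
  by (simp add: nat_less_iff)

text \<open>Subtracting \<open>k\<close> modulo \<open>n\<close> permutes the residues
  \<open>0, ..., n - 1\<close>; adding \<open>k\<close> is the inverse.\<close>

lemma circulant_row_sum:
  fixes f :: "nat \<Rightarrow> 'a :: comm_monoid_add"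
  assumes "n > 0"
  shows "(\<Sum>c<n. f (nat ((int c - k) mod int n))) = (\<Sum>i<n. f i)"
  by (rule sum.reindex_bij_witness[where i = "\<lambda>i. nat ((int i + k) mod int n)"
        and j = "\<lambda>c. nat ((int c - k) mod int n)"])
     (use assms in \<open>auto simp: circulant_index_less mod_simps\<close>)

text \<open>The reflection of residues at \<open>k\<close> is an involution, so the same map serves
  as both witnesses.\<close>

lemma circulant_col_sum:
  fixes f :: "nat \<Rightarrow> 'a :: comm_monoid_add"
  assumes "n > 0"
  shows "(\<Sum>r<n. f (nat ((k - int r) mod int n))) = (\<Sum>i<n. f i)"
  by (rule sum.reindex_bij_witness[where i = "\<lambda>i. nat ((k - int i) mod int n)"
        and j = "\<lambda>r. nat ((k - int r) mod int n)"])
     (use assms in \<open>auto simp: circulant_index_less mod_simps\<close>)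

lemma spectral_norm_circulant:
  fixes f :: "nat \<Rightarrow> real"
  assumes n: "n > 0" and nonneg: "\<And>i. i < n \<Longrightarrow> f i \<ge> 0"
  shows "spectral_norm (map_mat complex_of_real (circulant (vec n f))) = (\<Sum>i<n. f i)"
proof (rule spectral_norm_const_line_sums[OF _ n])
  have entry: "circulant (vec n f) $$ (r, c) = f (nat ((int c - int r) mod int n))"
    if "r < n" "c < n" for r c
    using that by (simp add: circulant_def circulant_index_less)
  show "circulant (vec n f) \<in> carrier_mat n n" by (simp add: circulant_def)
  show "circulant (vec n f) $$ (r, c) \<ge> 0" if "r < n" "c < n" for r c
    using that n by (simp add: entry nonneg circulant_index_less)
  show "(\<Sum>c<n. circulant (vec n f) $$ (r, c)) = (\<Sum>i<n. f i)" if "r < n" for r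
    using that n by (simp add: entry circulant_row_sum)
  show "(\<Sum>r<n. circulant (vec n f) $$ (r, c)) = (\<Sum>i<n. f i)" if "c < n" for c
    using that n by (simp add: entry circulant_col_sum)
qed

text \<open>Passing from \<open>m\<close> to \<open>m + 1\<close> adds
  \<open>(p + q - 1) * h_(m+1)\<close> to either side, on the right by the recurrence. The form
  without division stays in the integers.\<close>

lemma horadam_sum:
  "(p + q - 1) * (\<Sum>i<Suc m. horadam a b p q i)
    = horadam a b p q (Suc m) + q * horadam a b p q m + (p - 1) * a - b"
  by (induction m) (simp_all add: algebra_simps)

text \<open>For \<open>p = 1 - q\<close> the recurrence rearranges to
  \<open>h_(m+2) + q * h_(m+1) = h_(m+1) + q * h_m\<close>; the constant is the value at
  \<open>m = 0\<close>.\<close>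

lemma horadam_invariant:
  assumes "p + q = 1"
  shows "horadam a b p q (Suc m) + q * horadam a b p q m = q * a + b"
proof -
  have p: "p = 1 - q" using assms by simp
  show ?thesis unfolding p by (induction m) (simp_all add: algebra_simps)
qed

text \<open>Here \<open>horadam_sum\<close> has left side 0 and says nothing about the sum. Instead,
  the invariant turns each new term \<open>(q + 1) * h_(m+1)\<close> into
  \<open>q * h_(m+1) - q * h_m + (q * a + b)\<close>, which telescopes.\<close>

lemma horadam_sum_degenerate:
  assumes "p + q = 1"
  shows "(q + 1) * (\<Sum>i<Suc m. horadam a b p q i)
    = q * horadam a b p q m + int m * (q * a + b) + a"
proof (induction m)
  case (Suc m)
  then show ?case
    using horadam_invariant[OF assms, of a b m] by (simp add: algebra_simps)
qed (simp add: algebra_simps)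

text \<open>The characteristic polynomial is \<open>(x - 1)^2\<close>; its double root 1 makes the
  sequence an arithmetic progression.\<close>

lemma horadam_2_neg1: "horadam a b 2 (-1) m = a + int m * (b - a)"
  by (induction m rule: induct_nat_012) (simp_all add: algebra_simps)

text \<open>This covers the case left open by \<open>horadam_sum_degenerate\<close>, whose factor
  \<open>q + 1\<close> vanishes; it is the sum of an arithmetic progression, doubled to avoid
  division in \<open>int\<close>.\<close>

lemma horadam_sum_2_neg1:
  "2 * (\<Sum>i<Suc m. horadam a b 2 (-1) i) = int (Suc m) * (horadam a b 2 (-1) m + a)"
  unfolding horadam_2_neg1 by (induction m) (simp_all add: algebra_simps)

theorem theorem3:
  fixes a b p q :: int and n :: nat and h :: "nat \<Rightarrow> real"
  defines "h \<equiv> \<lambda>i. real_of_int (horadam a b p q i)"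
  assumes "n \<ge> 1"
    and "\<And>i. i < n \<Longrightarrow> h i \<ge> 0"
  shows "spectral_norm (map_mat complex_of_real (circulant (vec n h))) = (\<Sum>i<n. h i)
    \<and> (p + q \<noteq> 1 \<longrightarrow>
        (\<Sum>i<n. h i) = (h n + of_int q * h (n - 1) + (of_int p - 1) * of_int a - of_int b)
                        / (of_int p + of_int q - 1))
    \<and> (p + q = 1 \<and> p \<noteq> 2 \<longrightarrow>
        (\<Sum>i<n. h i) = (of_int q * h (n - 1) + (real n - 1) * (of_int q * of_int a + of_int b) + of_int a)
                        / (of_int q + 1))
    \<and> (p = 2 \<and> q = -1 \<longrightarrow>
        (\<Sum>i<n. h i) = real n * ((h (n - 1) + of_int a) / 2))"
proof (intro conjI impI)
  show "spectral_norm (map_mat complex_of_real (circulant (vec n h))) = (\<Sum>i<n. h i)"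
    using assms(2,3) by (intro spectral_norm_circulant) auto
  \<comment> \<open>With \<open>n = Suc m\<close>, the truncated difference \<open>n - 1\<close> is
    exactly \<open>m\<close>, and \<open>real n - 1\<close> is \<open>real m\<close>.\<close>
  obtain m where n: "n = Suc m" using assms(2) by (cases n) auto
  have sum_h: "(\<Sum>i<n. h i) = real_of_int (\<Sum>i<Suc m. horadam a b p q i)"
    by (simp add: h_def n)
  show "(\<Sum>i<n. h i) = (h n + of_int q * h (n - 1) + (of_int p - 1) * of_int a - of_int b)
      / (of_int p + of_int q - 1)" if "p + q \<noteq> 1"
  proof -
    have "real_of_int (p + q - 1) \<noteq> 0" using that by linarith
    then have "real_of_int p + of_int q - 1 \<noteq> 0" by simp
    moreover have "(real_of_int p + of_int q - 1) * (\<Sum>i<n. h i)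
        = h n + of_int q * h (n - 1) + (of_int p - 1) * of_int a - of_int b"
      using arg_cong[OF horadam_sum[of p q a b m], of real_of_int] unfolding sum_h
      by (simp add: h_def n del: sum.lessThan_Suc horadam.simps)
    ultimately show ?thesis by (simp add: eq_divide_eq mult.commute)
  qed
  show "(\<Sum>i<n. h i) = (of_int q * h (n - 1) + (real n - 1) * (of_int q * of_int a + of_int b)
      + of_int a) / (of_int q + 1)" if "p + q = 1 \<and> p \<noteq> 2"
  proof -
    \<comment> \<open>Under \<open>p + q = 1\<close>, the condition \<open>p \<noteq> 2\<close>
      amounts to \<open>q \<noteq> -1\<close>.\<close>
    have "real_of_int (q + 1) \<noteq> 0" using that by linarith
    then have "real_of_int q + 1 \<noteq> 0" by simp
    moreover have "(real_of_int q + 1) * (\<Sum>i<n. h i)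
        = of_int q * h (n - 1) + (real n - 1) * (of_int q * of_int a + of_int b) + of_int a"
      using arg_cong[OF horadam_sum_degenerate[of p q a b m], of real_of_int] that unfolding sum_h
      by (simp add: h_def n del: sum.lessThan_Suc horadam.simps)
    ultimately show ?thesis by (simp add: eq_divide_eq mult.commute)
  qed
  show "(\<Sum>i<n. h i) = real n * ((h (n - 1) + of_int a) / 2)" if "p = 2 \<and> q = -1"
    using arg_cong[OF horadam_sum_2_neg1[of a b m], of real_of_int] that unfolding sum_h
    by (simp add: h_def n del: sum.lessThan_Suc horadam.simps)
qed

end
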